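(* There exist strongly quasipositive links whose Conway polynomial is non-positive, i.e. is not positive: at least one of its coefficients is negative.
   Context: $\mathbb{B}_n$ is the braid group on $n$ strands with Artin generators $\sigma_1,\dots,\sigma_{n-1}$, relations $\sigma_i\sigma_j\sigma_i=\sigma_j\sigma_i\sigma_j$ for $|i-j|=1$ and $\sigma_i\sigma_j=\sigma_j\sigma_i$ for $|i-j|>1$. The closure $\widehat{\alpha}$ of a braid $\alpha$ is an oriented link with all strands oriented in parallel, with the convention that each $\sigma_i$ gives a positive crossing. The Birman–Ko–Lee (BKL, or band) generators of $\mathbb{B}_n$ are, for $1\le i<j\le n$, $\sigma_{ij}=(\sigma_{j-2}\cdots\sigma_i)^{-1}\sigma_{j-1}(\sigma_{j-2}\cdots\sigma_i)$ (with the product $\sigma_{j-2}\cdots\sigma_i$ empty when $j=i+1$, so $\sigma_{i,i+1}=\sigma_i$). A braid is BKL-positive if it can be written as a word in the BKL generators with only positive exponents. A link is strongly quasipositive (equivalently, BKL-positive) if it is the closure of a BKL-positive braid, on some number of strands. The Conway polynomial $\nabla(L)\in\mathbb{Z}[z]$ of an oriented link is the invariant determined by $\nabla(\text{unknot})=1$ and the skein relation $\nabla(L_+)-\nabla(L_-)=z\nabla(L_0)$, where $L_+,L_-,L_0$ have diagrams identical outside a small disc, inside which they have respectively a positive crossing, a negative crossing, and the oriented smoothing. A Conway polynomial is called positive if all its coefficients are non-negative. *)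

theory Defs
  imports "HOL-Computational_Algebra.Polynomial"
begin

section \<open>Oriented link diagrams\<close>

text \<open>
  A planar link diagram in general position with respect to the height function is cut by horizontal
  lines into slices containing one maximum, minimum or crossing each, and is recorded as the
  list of these elementary pieces from bottom to top.  The number is the horizontal position (counted from 0) of
  the left one of the two strands involved; all other strands of the slice are vertical.
  \<^item> \<open>Cup i u\<close> is a local minimum, creating strands \<open>i\<close> and \<open>i + 1\<close>; its left leg is oriented
    upwards iff \<open>u\<close>, its right leg oppositely.
  \<^item> \<open>Cap i\<close> is a local maximum joining strands \<open>i\<close> and \<open>i + 1\<close>.
  \<^item> \<open>Cross i c\<close> is a crossing of strands \<open>i\<close> and \<open>i + 1\<close>; the strand running from bottom left to
    top right is the overpass iff \<open>c\<close>.
\<close>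

datatype piece = Cup nat bool | Cap nat | Cross nat bool

type_synonym diagram = "piece list"

text \<open>
  The state at a given height is the list of the orientations (\<^const>\<open>True\<close> for upwards) of the
  strands met there, from left to right. \<^const>\<open>None\<close> means that the piece does not fit.
\<close>

fun attach :: "piece \<Rightarrow> bool list \<Rightarrow> bool list option" where
  "attach (Cup i u) s =
     (if i \<le> length s then Some (take i s @ [u, \<not> u] @ drop i s) else None)"
| "attach (Cap i) s =
     (if i + 1 < length s \<and> s ! i \<noteq> s ! (i + 1) then Some (take i s @ drop (i + 2) s) else None)"
| "attach (Cross i c) s =
     (if i + 1 < length s then Some (take i s @ [s ! (i + 1), s ! i] @ drop (i + 2) s) else None)"

fun run :: "diagram \<Rightarrow> bool list \<Rightarrow> bool list option" where
  "run [] s = Some s"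
| "run (p # D) s = Option.bind (attach p s) (run D)"

definition link_diagram :: "diagram \<Rightarrow> bool" where
  "link_diagram D \<longleftrightarrow> D \<noteq> [] \<and> run D [] = Some []"

section \<open>Isotopy and oriented links\<close>

fun shape :: "piece \<Rightarrow> nat \<Rightarrow> piece" where
  "shape (Cup _ u) = (\<lambda>i. Cup i u)"
| "shape (Cap _) = Cap"
| "shape (Cross _ c) = (\<lambda>i. Cross i c)"

fun in_width :: "piece \<Rightarrow> nat" where
  "in_width (Cup _ _) = 0" | "in_width (Cap _) = 2" | "in_width (Cross _ _) = 2"

fun out_width :: "piece \<Rightarrow> nat" where
  "out_width (Cup _ _) = 2" | "out_width (Cap _) = 0" | "out_width (Cross _ _) = 2"

text \<open>
  The standard local moves generating isotopy of sliced diagrams (Freyd--Yetter, Turaev): the first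
  five rules are the planar isotopies (exchanging the heights of two distant pieces, straightening
  a zigzag, pulling a strand across a minimum or maximum), the others the Reidemeister moves.
  Orientations are carried along: a move is only applied between two link diagrams, see
  \<open>move\<close> below.  In \<open>reidemeister3\<close>, the three Booleans say which strand is on top for the
  pairs (1,2), (1,3), (2,3) of strands; the premise excludes the two cyclic patterns.
\<close>

inductive local_move :: "diagram \<Rightarrow> diagram \<Rightarrow> bool" where
  exchange: "i \<le> j \<Longrightarrow>
     local_move [shape p i, shape q (j + out_width p)] [shape q (j + in_width p), shape p i]"
| zigzag_left: "local_move [Cup i u, Cap (i + 1)] []"
| zigzag_right: "local_move [Cup (i + 1) u, Cap i] []"
| slide_cup: "local_move [Cup i u, Cross (i + 1) c] [Cup (i + 1) u, Cross i (\<not> c)]"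
| slide_cap: "local_move [Cross (i + 1) c, Cap i] [Cross i (\<not> c), Cap (i + 1)]"
| reidemeister1_right: "local_move [Cup (i + 1) u, Cross i c, Cap (i + 1)] []"
| reidemeister1_left: "local_move [Cup i u, Cross (i + 1) c, Cap i] []"
| reidemeister2: "local_move [Cross i c, Cross i (\<not> c)] []"
| reidemeister3: "\<not> (a = c \<and> b \<noteq> a) \<Longrightarrow>
     local_move [Cross i a, Cross (i + 1) b, Cross i c]
                [Cross (i + 1) c, Cross i b, Cross (i + 1) a]"

definition move :: "diagram \<Rightarrow> diagram \<Rightarrow> bool" where
  "move D E \<longleftrightarrow> link_diagram D \<and> link_diagram E \<and>
     (\<exists>A B X Y. D = A @ X @ B \<and> E = A @ Y @ B \<and> local_move X Y)"

definition isotopic :: "diagram \<Rightarrow> diagram \<Rightarrow> bool" where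
  "isotopic D E \<longleftrightarrow> link_diagram D \<and> link_diagram E \<and> equivclp move D E"

quotient_type link = diagram / partial: isotopic morphisms rep_link link_of
proof (rule part_equivpI)
  show "\<exists>D. isotopic D D"
    by (rule exI [of _ "[Cup 0 True, Cap 0]"]) (simp add: isotopic_def link_diagram_def equivclp_def)
  show "symp isotopic"
    by (auto intro!: sympI simp: isotopic_def intro: equivclp_sym)
  show "transp isotopic"
    by (auto intro!: transpI simp: isotopic_def intro: equivclp_trans)
qed

definition unknot :: link where
  "unknot = link_of [Cup 0 True, Cap 0]"

section \<open>The Conway polynomial\<close>

text \<open>
  With both strands pointing upwards or both downwards, a crossing is positive iff the strand from
  bottom left to top right is on top; with strands pointing in opposite vertical directions it is
  the other way round.  The oriented smoothing consists of two vertical strands in the first case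
  and of a maximum below a minimum in the second.
\<close>

definition positive_crossing :: "bool list \<Rightarrow> nat \<Rightarrow> bool \<Rightarrow> bool" where
  "positive_crossing s i c \<longleftrightarrow> c = (s ! i = s ! (i + 1))"

definition smoothing :: "bool list \<Rightarrow> nat \<Rightarrow> diagram" where
  "smoothing s i = (if s ! i = s ! (i + 1) then [] else [Cap i, Cup i (s ! (i + 1))])"

definition skein_triple :: "diagram \<Rightarrow> diagram \<Rightarrow> diagram \<Rightarrow> bool" where
  "skein_triple Dp Dm D0 \<longleftrightarrow> link_diagram Dp \<and>
     (\<exists>A B s i c. run A [] = Some s \<and> positive_crossing s i c \<and>
        Dp = A @ [Cross i c] @ B \<and>
        Dm = A @ [Cross i (\<not> c)] @ B \<and>
        D0 = A @ smoothing s i @ B)"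

text \<open>
  The variable \<open>z\<close> is the polynomial \<open>[:0, 1:]\<close>.  It is classical that exactly one function
  satisfies the following.
\<close>

definition is_conway_polynomial :: "(link \<Rightarrow> int poly) \<Rightarrow> bool" where
  "is_conway_polynomial conway \<longleftrightarrow> conway unknot = 1 \<and>
     (\<forall>Dp Dm D0. skein_triple Dp Dm D0 \<longrightarrow>
        conway (link_of Dp) - conway (link_of Dm) = [:0, 1:] * conway (link_of D0))"

definition positive_polynomial :: "int poly \<Rightarrow> bool" where
  "positive_polynomial p \<longleftrightarrow> (\<forall>k. coeff p k \<ge> 0)"

section \<open>Braids and their closures\<close>

text \<open>
  Elements of the braid group on \<open>n\<close> strands are represented by words in the Artin generators, where
  \<open>(k, True)\<close> stands for \<open>\<sigma>\<^sub>k\<close> and \<open>(k, False)\<close> for its inverse; \<open>braid_eq n\<close> is equality in the group.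
\<close>

type_synonym braid_word = "(nat \<times> bool) list"

definition braid_words :: "nat \<Rightarrow> braid_word set" where
  "braid_words n = lists ({1..<n} \<times> UNIV)"

inductive braid_relation :: "braid_word \<Rightarrow> braid_word \<Rightarrow> bool" where
  cancel: "braid_relation [(k, e), (k, \<not> e)] []"
| braid: "braid_relation [(k, True), (k + 1, True), (k, True)] [(k + 1, True), (k, True), (k + 1, True)]"
| commute: "k + 1 < l \<Longrightarrow> braid_relation [(k, True), (l, True)] [(l, True), (k, True)]"

definition braid_step :: "nat \<Rightarrow> braid_word \<Rightarrow> braid_word \<Rightarrow> bool" where
  "braid_step n v w \<longleftrightarrow> v \<in> braid_words n \<and> w \<in> braid_words n \<and>
     (\<exists>a b x y. v = a @ x @ b \<and> w = a @ y @ b \<and> braid_relation x y)"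

definition braid_eq :: "nat \<Rightarrow> braid_word \<Rightarrow> braid_word \<Rightarrow> bool" where
  "braid_eq n v w \<longleftrightarrow> v \<in> braid_words n \<and> w \<in> braid_words n \<and> equivclp (braid_step n) v w"

definition inverse_word :: "braid_word \<Rightarrow> braid_word" where
  "inverse_word w = map (\<lambda>(k, e). (k, \<not> e)) (rev w)"

definition bkl_generator :: "nat \<Rightarrow> nat \<Rightarrow> braid_word" where
  "bkl_generator i j =
     (let w = map (\<lambda>k. (k, True)) (rev [i..<j - 1])
      in inverse_word w @ [(j - 1, True)] @ w)"

definition bkl_positive :: "nat \<Rightarrow> braid_word \<Rightarrow> bool" where
  "bkl_positive n w \<longleftrightarrow>
     (\<exists>gs. (\<forall>(i, j) \<in> set gs. 1 \<le> i \<and> i < j \<and> j \<le> n) \<and>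
           braid_eq n w (concat (map (\<lambda>(i, j). bkl_generator i j) gs)))"

text \<open>
  The braid is read from bottom to top on strands \<open>0, \<dots>, n - 1\<close>, all oriented upwards, and closed
  by \<open>n\<close> nested arcs on its right.
\<close>

definition closure_diagram :: "nat \<Rightarrow> braid_word \<Rightarrow> diagram" where
  "closure_diagram n w =
     map (\<lambda>k. Cup k True) [0..<n] @ map (\<lambda>(k, e). Cross (k - 1) e) w @ map Cap (rev [0..<n])"

definition braid_closure :: "nat \<Rightarrow> braid_word \<Rightarrow> link" where
  "braid_closure n w = link_of (closure_diagram n w)"

definition strongly_quasipositive :: "link \<Rightarrow> bool" where
  "strongly_quasipositive L \<longleftrightarrow>
     (\<exists>n\<ge>1. \<exists>w \<in> braid_words n. bkl_positive n w \<and> L = braid_closure n w)"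

end

theory Submission
  imports Defs
begin

text \<open>
  The closure of the 4-strand braid
  \<open>\<sigma>\<^sub>1\<^sub>2 \<sigma>\<^sub>2\<^sub>4 \<sigma>\<^sub>1\<^sub>3 \<sigma>\<^sub>2\<^sub>4 \<sigma>\<^sub>2\<^sub>3 \<sigma>\<^sub>1\<^sub>3\<close> has Conway polynomial \<open>-z\<^sup>3\<close>.
  A braid word on \<open>n + 1\<close> strands that does not involve the last generator has Conway polynomial \<open>0\<close>; if it
  involves the last generator exactly once, this crossing can be removed by a Reidemeister I move together with the
  last strand, at whatever place of the word it occurs, so that no conjugation is needed.  All other
  words are reduced to these by Reidemeister II and III moves, far commutation and the skein relation
  at two equal consecutive letters.
\<close>

section \<open>Closure diagrams and the orientations of their strands\<close>

definition crossings :: "braid_word \<Rightarrow> diagram" where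
  "crossings w = map (\<lambda>(k, e). Cross (k - 1) e) w"

lemma crossings_simps [simp]:
  "crossings [] = []"
  "crossings (x # w) = Cross (fst x - 1) (snd x) # crossings w"
  "crossings (u @ w) = crossings u @ crossings w"
  by (simp_all add: crossings_def split: prod.split)

text \<open>Cups and caps are separated from the crossings so that passing from \<open>n\<close> to
  \<open>Suc n\<close> adds the innermost arc, next to the crossings. This is the arc that
  destabilization removes.\<close>

definition cups :: "nat \<Rightarrow> diagram" where
  "cups n = map (\<lambda>k. Cup k True) [0..<n]"

definition caps :: "nat \<Rightarrow> diagram" where
  "caps n = map Cap (rev [0..<n])"

lemma cups_simps [simp]: "cups 0 = []" "cups (Suc n) = cups n @ [Cup n True]"
  by (simp_all add: cups_def)

lemma cups_eq_Nil [simp]: "cups n = [] \<longleftrightarrow> n = 0"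
  by (simp add: cups_def)

lemma caps_simps [simp]: "caps 0 = []" "caps (Suc n) = Cap n # caps n"
  by (simp_all add: caps_def)

text \<open>The state at every level of the braid part: first the braid strands, then the return
  strands of the closing arcs. Braid crossings exchange parallel strands and so leave it
  unchanged.\<close>

definition closure_state :: "nat \<Rightarrow> bool list" where
  "closure_state n = replicate n True @ replicate n False"

lemma run_append: "run (A @ B) s = Option.bind (run A s) (run B)"
  by (induction A arbitrary: s) (auto simp: Option.bind_assoc split: Option.bind_split)

lemma length_closure_state [simp]: "length (closure_state n) = 2 * n"
  by (simp add: closure_state_def)

lemma nth_closure_state: "i < n \<Longrightarrow> closure_state n ! i = True"
  by (simp add: closure_state_def nth_append)

lemma closure_state_Suc: "closure_state (Suc n) = replicate n True @ [True, False] @ replicate n False"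
  by (simp add: closure_state_def replicate_append_same)

lemma attach_Cup_closure_state: "attach (Cup n True) (closure_state n) = Some (closure_state (Suc n))"
  unfolding closure_state_Suc by (simp add: closure_state_def)

lemma attach_Cap_closure_state: "attach (Cap n) (closure_state (Suc n)) = Some (closure_state n)"
  unfolding closure_state_Suc by (simp add: closure_state_def nth_append)

lemma swap_equal_neighbours:
  assumes "i + 1 < length s" "s ! i = s ! (i + 1)"
  shows "take i s @ [s ! (i + 1), s ! i] @ drop (i + 2) s = s"
  using assms by (metis Cons_nth_drop_Suc Suc_eq_plus1 Suc_lessD add_2_eq_Suc' append_Cons append_Nil append_take_drop_id)

lemma attach_Cross_closure_state:
  assumes "Suc i < n"
  shows "attach (Cross i e) (closure_state n) = Some (closure_state n)"
  using assms swap_equal_neighbours[of i "closure_state n"] by (simp add: nth_closure_state)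

lemma run_cups: "run (cups n) [] = Some (closure_state n)"
  by (induction n) (simp_all add: run_append attach_Cup_closure_state del: attach.simps, simp add: closure_state_def)

lemma run_caps: "run (caps n) (closure_state n) = Some []"
  by (induction n) (simp_all add: attach_Cap_closure_state del: attach.simps, simp add: closure_state_def)

lemma run_crossings:
  assumes "w \<in> braid_words n"
  shows "run (crossings w) (closure_state n) = Some (closure_state n)"
  using assms
proof (induction w)
  case (Cons x w)
  obtain k e where x: "x = (k, e)" by force
  have k: "1 \<le> k" "k < n" and w: "w \<in> braid_words n"
    using Cons.prems by (auto simp: braid_words_def x)
  then show ?case
    using Cons.IH k by (simp add: x attach_Cross_closure_state del: attach.simps)
qed simp

lemma closure_diagram_eq: "closure_diagram n w = cups n @ crossings w @ caps n"
  by (simp add: closure_diagram_def cups_def crossings_def caps_def)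

lemma link_diagram_closure:
  assumes "n \<ge> 1" "w \<in> braid_words n"
  shows "link_diagram (closure_diagram n w)"
  using assms by (auto simp: link_diagram_def closure_diagram_eq run_append run_cups
      run_crossings run_caps)

section \<open>Isotopies of closures given by moves on braid words\<close>

lemma link_of_local_move:
  assumes "link_diagram (A @ X @ B)" "link_diagram (A @ Y @ B)" "local_move X Y"
  shows "link_of (A @ X @ B) = link_of (A @ Y @ B)"
proof -
  have "move (A @ X @ B) (A @ Y @ B)"
    using assms by (auto simp: move_def)
  then have "isotopic (A @ X @ B) (A @ Y @ B)"
    using assms by (auto simp: isotopic_def)
  then show ?thesis
    using Quotient3_rel[OF Quotient3_link] by (auto simp: isotopic_def)
qed

lemma braid_words_append [simp]:
  "u @ v \<in> braid_words n \<longleftrightarrow> u \<in> braid_words n \<and> v \<in> braid_words n"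
  by (auto simp: braid_words_def)

lemma braid_words_Cons [simp]:
  "x # v \<in> braid_words n \<longleftrightarrow> 1 \<le> fst x \<and> fst x < n \<and> v \<in> braid_words n"
  by (cases x) (auto simp: braid_words_def)

lemma braid_words_Nil [simp]: "[] \<in> braid_words n"
  by (simp add: braid_words_def)

lemma braid_words_mono: "w \<in> braid_words m \<Longrightarrow> m \<le> n \<Longrightarrow> w \<in> braid_words n"
  unfolding braid_words_def by (erule lists_mono[THEN subsetD, rotated]) auto

lemma braid_closure_local_move:
  assumes "n \<ge> 1" "u @ x @ v \<in> braid_words n" "u @ y @ v \<in> braid_words n"
    and "local_move (crossings x) (crossings y)"
  shows "braid_closure n (u @ x @ v) = braid_closure n (u @ y @ v)"
proof -
  have "link_of ((cups n @ crossings u) @ crossings x @ (crossings v @ caps n)) =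
        link_of ((cups n @ crossings u) @ crossings y @ (crossings v @ caps n))"
    using assms link_diagram_closure[of n "u @ x @ v"] link_diagram_closure[of n "u @ y @ v"]
    by (intro link_of_local_move) (simp_all add: closure_diagram_eq)
  then show ?thesis
    by (simp add: braid_closure_def closure_diagram_eq)
qed

lemma braid_closure_cancel:
  assumes "n \<ge> 1" "u @ v \<in> braid_words n" "1 \<le> k" "k < n" "d \<noteq> e"
  shows "braid_closure n (u @ [(k, d), (k, e)] @ v) = braid_closure n (u @ v)"
  using assms braid_closure_local_move[of n u "[(k, d), (k, e)]" v "[]"] reidemeister2[of "k - 1" d]
  by (cases d; cases e) auto

lemma braid_closure_commute:
  assumes "n \<ge> 1" "u @ v \<in> braid_words n" "1 \<le> k" "k + 1 < l" "l < n"
  shows "braid_closure n (u @ [(k, d), (l, e)] @ v) = braid_closure n (u @ [(l, e), (k, d)] @ v)"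
proof -
  have "local_move (crossings [(k, d), (l, e)]) (crossings [(l, e), (k, d)])"
    \<comment> \<open>\<open>shape\<close> discards the dummy position 0. The rule adds the width 2
      of a crossing to its second index, so \<open>l - 3\<close> stands for position
      \<open>l - 1\<close>, and \<open>k + 1 < l\<close> gives
      \<open>k - 1 \<le> l - 3\<close>.\<close>
    using exchange[of "k - 1" "l - 3" "Cross 0 d" "Cross 0 e"] assms
    by (simp add: numeral_2_eq_2 numeral_3_eq_3 Suc_diff_Suc)
  then show ?thesis
    using assms by (intro braid_closure_local_move) auto
qed

text \<open>The third Reidemeister move also covers mixed signs, such as \<open>\<sigma>\<^sub>1
  \<sigma>\<^sub>2 \<sigma>\<^sub>1\<^sup>-\<^sup>1 = \<sigma>\<^sub>2\<^sup>-\<^sup>1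
  \<sigma>\<^sub>1 \<sigma>\<^sub>2\<close>, without inserting cancelling pairs.\<close>

lemma braid_closure_braid:
  assumes "n \<ge> 1" "u @ v \<in> braid_words n" "1 \<le> k" "k + 1 < n" "\<not> (a = c \<and> b \<noteq> a)"
  shows "braid_closure n (u @ [(k, a), (k + 1, b), (k, c)] @ v) =
         braid_closure n (u @ [(k + 1, c), (k, b), (k + 1, a)] @ v)"
proof -
  have "local_move (crossings [(k, a), (k + 1, b), (k, c)]) (crossings [(k + 1, c), (k, b), (k + 1, a)])"
    using reidemeister3[of a c b "k - 1"] assms by simp
  then show ?thesis
    using assms by (intro braid_closure_local_move) auto
qed

section \<open>Removing the last strand by a Reidemeister I move\<close>

text \<open>The cup lies to the right of all crossings of \<open>u\<close>, so it can be exchanged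
  with them one by one; in the induction \<open>P\<close> absorbs the crossings already passed. The
  two \<open>run\<close> hypotheses make every intermediate diagram a link diagram, as
  \<open>move\<close> demands.\<close>

lemma link_of_cup_past_crossings:
  assumes "run P [] = Some (closure_state n)" "run R (closure_state (Suc n)) = Some []"
    and "u \<in> braid_words n"
  shows "link_of (P @ Cup n True # crossings u @ R) = link_of (P @ crossings u @ Cup n True # R)"
  using assms
proof (induction u arbitrary: P)
  case (Cons x u)
  obtain k e where x: "x = (k, e)" by force
  let ?X = "Cross (k - 1) e"
  have k: "1 \<le> k" "k < n" and u: "u \<in> braid_words n"
    using Cons.prems by (auto simp: x)
  \<comment> \<open>The crossing meets \<open>n\<close> braid strands when it lies below the cup and
    \<open>Suc n\<close> when it lies above, so both values of \<open>m\<close> occur.\<close>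
  have X: "attach ?X (closure_state m) = Some (closure_state m)" if "n \<le> m" for m
    using k that by (intro attach_Cross_closure_state) simp
  have u': "run (crossings u) (closure_state (Suc n)) = Some (closure_state (Suc n))"
    using u by (intro run_crossings) (auto elim: braid_words_mono)
  have lm: "local_move [?X, Cup n True] [Cup n True, ?X]"
    using exchange[of "k - 1" "n - 2" "Cross 0 e" "Cup 0 True"] k
    by (simp add: numeral_2_eq_2 Suc_diff_Suc)
  have P': "run (P @ [?X]) [] = Some (closure_state n)"
    using Cons.prems X[of n] by (simp add: run_append del: attach.simps)
  have "link_of (P @ [?X, Cup n True] @ (crossings u @ R)) = link_of (P @ [Cup n True, ?X] @ (crossings u @ R))"
  proof (rule link_of_local_move[OF _ _ lm])
    show "link_diagram (P @ [?X, Cup n True] @ (crossings u @ R))"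
      using Cons.prems X[of n] u' attach_Cup_closure_state[of n]
      by (simp add: link_diagram_def run_append del: attach.simps)
    show "link_diagram (P @ [Cup n True, ?X] @ (crossings u @ R))"
      using Cons.prems X[of "Suc n"] u' attach_Cup_closure_state[of n]
      by (simp add: link_diagram_def run_append del: attach.simps)
  qed
  then show ?case
    using Cons.IH[OF P' Cons.prems(2) u] by (simp add: x)
qed simp

lemma link_of_cap_past_crossings:
  assumes "run P [] = Some (closure_state (Suc n))" "run R (closure_state n) = Some []"
    and "u \<in> braid_words n"
  shows "link_of (P @ Cap n # crossings u @ R) = link_of (P @ crossings u @ Cap n # R)"
  using assms
proof (induction u arbitrary: P)
  case (Cons x u)
  obtain k e where x: "x = (k, e)" by force
  let ?X = "Cross (k - 1) e"
  have k: "1 \<le> k" "k < n" and u: "u \<in> braid_words n"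
    using Cons.prems by (auto simp: x)
  have X: "attach ?X (closure_state m) = Some (closure_state m)" if "n \<le> m" for m
    using k that by (intro attach_Cross_closure_state) simp
  have u': "run (crossings u) (closure_state n) = Some (closure_state n)"
    using u by (rule run_crossings)
  have lm: "local_move [?X, Cap n] [Cap n, ?X]"
    using exchange[of "k - 1" "n - 2" "Cross 0 e" "Cap 0"] k
    by (simp add: numeral_2_eq_2 Suc_diff_Suc)
  have P': "run (P @ [?X]) [] = Some (closure_state (Suc n))"
    using Cons.prems X[of "Suc n"] by (simp add: run_append del: attach.simps)
  have "link_of (P @ [?X, Cap n] @ (crossings u @ R)) = link_of (P @ [Cap n, ?X] @ (crossings u @ R))"
  proof (rule link_of_local_move[OF _ _ lm])
    show "link_diagram (P @ [?X, Cap n] @ (crossings u @ R))"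
      using Cons.prems X[of "Suc n"] u' attach_Cap_closure_state[of n]
      by (simp add: link_diagram_def run_append del: attach.simps)
    show "link_diagram (P @ [Cap n, ?X] @ (crossings u @ R))"
      using Cons.prems X[of n] u' attach_Cap_closure_state[of n]
      by (simp add: link_diagram_def run_append del: attach.simps)
  qed
  then show ?case
    using Cons.IH[OF P' Cons.prems(2) u] by (simp add: x)
qed simp

text \<open>The innermost cup is raised through \<open>u\<close> and the innermost cap lowered
  through \<open>v\<close> until they enclose the single crossing of the last strand, which is then
  a kink.\<close>

lemma braid_closure_destabilize:
  assumes n: "n \<ge> 1" and u: "u \<in> braid_words n" and v: "v \<in> braid_words n"
  shows "braid_closure (Suc n) (u @ [(n, e)] @ v) = braid_closure n (u @ v)"
proof -
  let ?X = "Cross (n - 1) e"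
  have X: "attach ?X (closure_state (Suc n)) = Some (closure_state (Suc n))"
    using n by (intro attach_Cross_closure_state) simp
  have Suc: "w \<in> braid_words n \<Longrightarrow> w \<in> braid_words (Suc n)" for w
    by (erule braid_words_mono) simp
  note simps = run_append run_cups run_crossings run_caps
    attach_Cup_closure_state attach_Cap_closure_state Suc u v
  have "braid_closure (Suc n) (u @ [(n, e)] @ v) =
        link_of (cups n @ Cup n True # crossings u @ ([?X] @ crossings v @ Cap n # caps n))"
    by (simp add: braid_closure_def closure_diagram_eq)
  also have "\<dots> = link_of (cups n @ crossings u @ Cup n True # ([?X] @ crossings v @ Cap n # caps n))"
    using X by (intro link_of_cup_past_crossings) (simp_all add: simps del: attach.simps)
  also have "\<dots> = link_of ((cups n @ crossings u @ [Cup n True, ?X]) @ crossings v @ Cap n # caps n)"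
    by simp
  also have "\<dots> = link_of ((cups n @ crossings u @ [Cup n True, ?X]) @ Cap n # crossings v @ caps n)"
    using X by (intro link_of_cap_past_crossings[symmetric]) (simp_all add: simps del: attach.simps)
  also have "\<dots> = link_of ((cups n @ crossings u) @ [Cup n True, ?X, Cap n] @ (crossings v @ caps n))"
    by simp
  also have "\<dots> = link_of ((cups n @ crossings u) @ [] @ (crossings v @ caps n))"
  proof (rule link_of_local_move)
    show "link_diagram ((cups n @ crossings u) @ [Cup n True, ?X, Cap n] @ (crossings v @ caps n))"
      using X by (simp add: link_diagram_def simps del: attach.simps)
    show "link_diagram ((cups n @ crossings u) @ [] @ (crossings v @ caps n))"
      using n by (simp add: link_diagram_def simps del: attach.simps)
    show "local_move [Cup n True, ?X, Cap n] []"
      using reidemeister1_right[of "n - 1" True e] n by simp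
  qed
  finally show ?thesis
    by (simp add: braid_closure_def closure_diagram_eq)
qed

section \<open>Rewriting braid words at given positions\<close>

text \<open>
  \<open>braid_move i w\<close> performs at position \<open>i\<close> the only cancellation, far commutation or
  braid relation (with any signs allowed by the third Reidemeister move) that fits there, if any.
\<close>

fun braid_move :: "nat \<Rightarrow> braid_word \<Rightarrow> braid_word" where
  "braid_move (Suc i) (x # w) = x # braid_move i w"
| "braid_move 0 ((k, a) # (l, b) # w) =
     (if k = l \<and> a \<noteq> b then w
      else if k + 1 < l \<or> l + 1 < k then (l, b) # (k, a) # w
      else case w of
        [] \<Rightarrow> (k, a) # (l, b) # w
      | (m, c) # w' \<Rightarrow>
          if m = k \<and> k \<noteq> l \<and> \<not> (a = c \<and> b \<noteq> a) then (l, c) # (k, b) # (l, a) # w'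
          else (k, a) # (l, b) # w)"
| "braid_move i w = w"

lemma braid_move_numeral [simp]:
  "braid_move (numeral i) (x # w) = x # braid_move (pred_numeral i) w"
  by (simp add: numeral_eq_Suc)

lemma braid_move_in_braid_words: "w \<in> braid_words n \<Longrightarrow> braid_move i w \<in> braid_words n"
  by (induction i w rule: braid_move.induct) (auto split: list.split)

lemma braid_closure_move:
  assumes "n \<ge> 1" "u @ w \<in> braid_words n"
  shows "braid_closure n (u @ braid_move i w) = braid_closure n (u @ w)"
  using assms
proof (induction i w arbitrary: u rule: braid_move.induct)
  case (1 i x w)
  then show ?case
    using "1.IH"[of "u @ [x]"] by simp
next
  case (2 k a l b w)
  have "k = l \<and> a \<noteq> b \<or> k + 1 < l \<or> l + 1 < k
      \<or> (\<exists>c w'. w = (k, c) # w' \<and> (l = k + 1 \<or> k = l + 1) \<and> \<not> (a = c \<and> b \<noteq> a))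
      \<or> braid_move 0 ((k, a) # (l, b) # w) = (k, a) # (l, b) # w"
    by (cases w) auto
  then consider (cancel) "k = l" "a \<noteq> b" | (commute) "k + 1 < l" | (commute') "l + 1 < k"
    | (braid) c w' where "w = (k, c) # w'" "\<not> (a = c \<and> b \<noteq> a)" "l = k + 1"
    | (braid') c w' where "w = (k, c) # w'" "\<not> (a = c \<and> b \<noteq> a)" "k = l + 1"
    | (fixed) "braid_move 0 ((k, a) # (l, b) # w) = (k, a) # (l, b) # w"
    by blast
  then show ?case
  proof cases
    case cancel
    then show ?thesis
      using 2 braid_closure_cancel[of n u w k a b] by simp
  next
    case commute
    then show ?thesis
      using 2 braid_closure_commute[of n u w k l a b] by simp
  next
    case commute'
    then show ?thesis
      using 2 braid_closure_commute[of n u w l k b a] by simp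
  next
    case braid
    then show ?thesis
      using 2 braid_closure_braid[of n u w' k a c b] by simp
  next
    case braid'
    then show ?thesis
      \<comment> \<open>Here the braid relation is read from right to left, hence the swapped outer
        signs.\<close>
      using 2 braid_closure_braid[of n u w' l c a b] by auto
  qed simp
qed simp_all

text \<open>Lets a list of positions serve as a certificate of isotopy: \<open>fold\<close> applies
  the moves from the head of the list on, and simplification computes the resulting word.\<close>

lemma braid_closure_moves:
  assumes "n \<ge> 1" "w \<in> braid_words n"
  shows "braid_closure n w = braid_closure n (fold braid_move is w)"
  using assms(2)
proof (induction "is" arbitrary: w)
  case (Cons i "is")
  then show ?case
    using braid_closure_move[of n "[]" w i] assms(1) by (simp add: braid_move_in_braid_words)
qed simp

section \<open>The skein relation for braid closures\<close>

lemma braid_closure_unknot: "braid_closure 1 [] = unknot"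
  by (simp add: braid_closure_def closure_diagram_def unknot_def)

text \<open>All braid strands point upwards, so the oriented smoothing just deletes the letter and
  the skein relation stays among closures on \<open>n\<close> strands.\<close>

lemma skein_triple_closure:
  assumes "n \<ge> 1" "u \<in> braid_words n" "v \<in> braid_words n" "1 \<le> k" "k < n"
  shows "skein_triple (closure_diagram n (u @ [(k, True)] @ v)) (closure_diagram n (u @ [(k, False)] @ v))
           (closure_diagram n (u @ v))"
proof -
  let ?s = "closure_state n"
  have "run (cups n @ crossings u) [] = Some ?s"
    using assms by (simp add: run_append run_cups run_crossings)
  moreover have "positive_crossing ?s (k - 1) True" "smoothing ?s (k - 1) = []"
    using assms by (simp_all add: positive_crossing_def smoothing_def nth_closure_state)
  moreover have "link_diagram (closure_diagram n (u @ [(k, True)] @ v))"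
    using assms by (intro link_diagram_closure) auto
  ultimately show ?thesis
    unfolding skein_triple_def closure_diagram_eq
    by (intro conjI exI[of _ "cups n @ crossings u"] exI[of _ "crossings v @ caps n"] exI[of _ ?s]
        exI[of _ "k - 1"] exI[of _ True]) simp_all
qed

locale conway_polynomial =
  fixes conway :: "link \<Rightarrow> int poly"
  assumes is_conway: "is_conway_polynomial conway"
begin

text \<open>The strand count matters: \<open>\<sigma>\<^sub>1\<^sup>3\<close> closes to a trefoil on
  two strands, but to a split link on three.\<close>

definition closure_conway :: "nat \<Rightarrow> braid_word \<Rightarrow> int poly" where
  "closure_conway n w = conway (braid_closure n w)"

lemma closure_conway_unknot: "closure_conway 1 [] = 1"
  using is_conway by (simp add: closure_conway_def braid_closure_unknot[simplified] is_conway_polynomial_def)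

lemma closure_conway_skein:
  assumes "n \<ge> 1" "u \<in> braid_words n" "v \<in> braid_words n" "1 \<le> k" "k < n"
  shows "closure_conway n (u @ [(k, True)] @ v) - closure_conway n (u @ [(k, False)] @ v) =
         [:0, 1:] * closure_conway n (u @ v)"
  using skein_triple_closure[OF assms] is_conway
  unfolding is_conway_polynomial_def closure_conway_def braid_closure_def by blast

lemma closure_conway_destabilize:
  assumes "n \<ge> 1" "u \<in> braid_words n" "v \<in> braid_words n"
  shows "closure_conway (Suc n) (u @ [(n, e)] @ v) = closure_conway n (u @ v)"
  using braid_closure_destabilize[OF assms] by (simp add: closure_conway_def)

text \<open>Both crossings \<open>\<sigma>\<^sub>n\<close> and \<open>\<sigma>\<^sub>n\<^sup>-\<^sup>1\<close> destabilize to the same link, so the skein relation kills the split closure.\<close>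

lemma closure_conway_split:
  assumes "n \<ge> 1" "w \<in> braid_words n"
  shows "closure_conway (Suc n) w = 0"
proof -
  have "[:0, 1:] * closure_conway (Suc n) w = 0"
    using closure_conway_skein[of "Suc n" w "[]" n] closure_conway_destabilize[of n w "[]"]
      braid_words_mono[of w n "Suc n"] assms by simp
  then show ?thesis
    by simp
qed

text \<open>Changing the sign of one of the two equal letters makes it cancel the other, so both
  remaining words are shorter.\<close>

lemma closure_conway_square:
  assumes "n \<ge> 1" "u \<in> braid_words n" "v \<in> braid_words n" "1 \<le> k" "k < n"
  shows "closure_conway n (u @ [(k, e), (k, e)] @ v) =
         closure_conway n (u @ v) + (if e then 1 else - 1) * [:0, 1:] * closure_conway n (u @ [(k, e)] @ v)"
  using closure_conway_skein[of n u "(k, e) # v" k] braid_closure_cancel[of n u v k e "\<not> e"]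
    braid_closure_cancel[of n u v k "\<not> e" e] assms
  by (cases e) (simp_all add: closure_conway_def algebra_simps)

lemma closure_conway_moves:
  assumes "n \<ge> 1" "w \<in> braid_words n"
  shows "closure_conway n w = closure_conway n (fold braid_move is w)"
  using braid_closure_moves[OF assms] by (simp add: closure_conway_def)

end

section \<open>The example and its Conway polynomial\<close>

definition example_bands :: "(nat \<times> nat) list" where
  "example_bands = [(1, 2), (2, 4), (1, 3), (2, 4), (2, 3), (1, 3)]"

definition example_braid :: braid_word where
  "example_braid = concat (map (\<lambda>(i, j). bkl_generator i j) example_bands)"

text \<open>A skein tree listed from the leaves to the root: every right-hand side is settled by
  earlier equations. The leaves are split closures, with value 0, and the unknot. Capital letters
  denote inverse generators.\<close>

lemma (in conway_polynomial) closure_conway_example: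
  "closure_conway 4 example_braid = [:0, 0, 0, - 1:]"
proof -
  let ?F = closure_conway and ?z = "[:0, 1:] :: int poly"
  let ?a = "(1 :: nat, True)" and ?b = "(2 :: nat, True)" and ?c = "(3 :: nat, True)"
  let ?A = "(1 :: nat, False)" and ?B = "(2 :: nat, False)" and ?C = "(3 :: nat, False)"
  note moves = closure_conway_moves and square = closure_conway_square
  note destab = closure_conway_destabilize and split = closure_conway_split
  have w1: "?F 4 [?a, ?B, ?a, ?b, ?b, ?A, ?b, ?a] = 0"
    using split[of 3 "[?a, ?B, ?a, ?b, ?b, ?A, ?b, ?a]"] by simp
  have w2: "?F 3 [?a, ?B, ?a, ?A, ?b, ?a] = 0"
    using moves[of 3 "[?a, ?B, ?a, ?A, ?b, ?a]" "[2, 1]"]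
      split[of 2 "[?a, ?a]"] by simp
  have w3: "?F 3 [?a, ?a, ?a] = 0"
    using split[of 2 "[?a, ?a, ?a]"] by simp
  have w4: "?F 2 [?a] = ?F 1 []"
    using destab[of 1 "[]" "[]" True] by (simp flip: numeral_2_eq_2)
  have w5: "?F 2 [] = 0"
    using split[of 1 "[]"] by (simp flip: numeral_2_eq_2)
  have w6: "?F 2 [?a, ?a] = ?F 2 [] + ?z * ?F 2 [?a]"
    using square[of 2 "[]" "[]" 1 True] by simp
  have w7: "?F 2 [?a, ?a, ?a] = ?F 2 [?a] + ?z * ?F 2 [?a, ?a]"
    using square[of 2 "[]" "[?a]" 1 True] by simp
  have w8: "?F 3 [?a, ?B, ?a, ?a] = ?F 2 [?a, ?a, ?a]"
    using destab[of 2 "[?a]" "[?a, ?a]" False] by simp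
  have w9: "?F 3 [?a, ?B, ?B, ?a, ?a] = ?F 3 [?a, ?a, ?a] - ?z * ?F 3 [?a, ?B, ?a, ?a]"
    using square[of 3 "[?a]" "[?a, ?a]" 2 False] by simp
  have w10: "?F 2 [?a, ?a, ?A, ?A, ?a] = ?F 1 []"
    using moves[of 2 "[?a, ?a, ?A, ?A, ?a]" "[1, 0]"]
      destab[of 1 "[]" "[]" True] by (simp flip: numeral_2_eq_2)
  have w11: "?F 3 [?a, ?B, ?B, ?a, ?b, ?a] = ?F 2 [?a, ?a, ?A, ?A, ?a]"
    using moves[of 3 "[?a, ?B, ?B, ?a, ?b, ?a]" "[2, 1]"]
      destab[of 2 "[?a, ?a]" "[?A, ?A, ?a]" True] by simp
  \<comment> \<open>The two terms are -z - z^3 and z, so the value is -z^3.\<close>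
  have w12: "?F 3 [?a, ?B, ?a, ?b, ?A, ?b, ?a] = ?F 3 [?a, ?B, ?B, ?a, ?a] + ?z * ?F 3 [?a, ?B, ?B, ?a, ?b, ?a]"
    using moves[of 3 "[?a, ?B, ?a, ?b, ?A, ?b, ?a]" "[2]"]
      square[of 3 "[?a, ?B, ?B, ?a]" "[?a]" 2 True] by simp
  have w13: "?F 3 [?a, ?B, ?a, ?b, ?b, ?A, ?b, ?a] = ?F 3 [?a, ?B, ?a, ?A, ?b, ?a] + ?z * ?F 3 [?a, ?B, ?a, ?b, ?A, ?b, ?a]"
    using square[of 3 "[?a, ?B, ?a]" "[?A, ?b, ?a]" 2 True] by simp
  have w14: "?F 4 [?a, ?B, ?a, ?b, ?C, ?b, ?A, ?b, ?a] = ?F 3 [?a, ?B, ?a, ?b, ?b, ?A, ?b, ?a]"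
    using destab[of 3 "[?a, ?B, ?a, ?b]" "[?b, ?A, ?b, ?a]" False] by simp
  have w15: "?F 4 [?a, ?B, ?a, ?b, ?C, ?C, ?b, ?A, ?b, ?a] = ?F 4 [?a, ?B, ?a, ?b, ?b, ?A, ?b, ?a] - ?z * ?F 4 [?a, ?B, ?a, ?b, ?C, ?b, ?A, ?b, ?a]"
    using square[of 4 "[?a, ?B, ?a, ?b]" "[?b, ?A, ?b, ?a]" 3 False] by simp
  have w16: "?F 3 [?a, ?a, ?a, ?B, ?b, ?a] = 0"
    using moves[of 3 "[?a, ?a, ?a, ?B, ?b, ?a]" "[3]"]
      split[of 2 "[?a, ?a, ?a, ?a]"] by simp
  have w17: "?F 2 [?a, ?a, ?a, ?a, ?A, ?a] = ?F 2 [?a, ?a] + ?z * ?F 2 [?a, ?a, ?a]"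
    using moves[of 2 "[?a, ?a, ?a, ?a, ?A, ?a]" "[3]"]
      square[of 2 "[]" "[?a, ?a]" 1 True] by simp
  have w18: "?F 3 [?a, ?a, ?a, ?B, ?A, ?b, ?a] = ?F 2 [?a, ?a, ?a, ?a, ?A, ?a]"
    using moves[of 3 "[?a, ?a, ?a, ?B, ?A, ?b, ?a]" "[3]"]
      destab[of 2 "[?a, ?a, ?a, ?a]" "[?A, ?a]" False] by simp
  have w19: "?F 3 [?a, ?a, ?B, ?B, ?b, ?A, ?b, ?A, ?b, ?a] = ?F 3 [?a, ?a, ?a, ?B, ?b, ?a] - ?z * ?F 3 [?a, ?a, ?a, ?B, ?A, ?b, ?a]"
    using moves[of 3 "[?a, ?a, ?B, ?B, ?b, ?A, ?b, ?A, ?b, ?a]" "[3, 2]"]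
      square[of 3 "[?a, ?a, ?a, ?B]" "[?b, ?a]" 1 False] by simp
  \<comment> \<open>The moves carry two letters \<open>\<sigma>\<^sub>3\<^sup>-\<^sup>1\<close>
    leftwards and turn them into letters in \<open>\<sigma>\<^sub>2\<close> by braid relations,
    leaving a single \<open>\<sigma>\<^sub>3\<close> to destabilize.\<close>
  have w20: "?F 4 [?a, ?c, ?B, ?a, ?b, ?C, ?C, ?b, ?A, ?b, ?a] = ?F 3 [?a, ?a, ?B, ?B, ?b, ?A, ?b, ?A, ?b, ?a]"
    using moves[of 4 "[?a, ?c, ?B, ?a, ?b, ?C, ?C, ?b, ?A, ?b, ?a]" "[2, 1, 4, 2, 5, 3]"]
      destab[of 3 "[?a, ?a, ?B, ?B]" "[?b, ?A, ?b, ?A, ?b, ?a]" True] by simp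
  \<comment> \<open>The values z^5 from \<open>w15\<close> and -2z^2 - z^4 from \<open>w20\<close>
    combine to -2z^3.\<close>
  have w21: "?F 4 [?a, ?c, ?c, ?B, ?a, ?b, ?C, ?C, ?b, ?A, ?b, ?a] = ?F 4 [?a, ?B, ?a, ?b, ?C, ?C, ?b, ?A, ?b, ?a] + ?z * ?F 4 [?a, ?c, ?B, ?a, ?b, ?C, ?C, ?b, ?A, ?b, ?a]"
    using square[of 4 "[?a]" "[?B, ?a, ?b, ?C, ?C, ?b, ?A, ?b, ?a]" 3 True] by simp
  have w22: "?F 3 [?a, ?a] = 0"
    using split[of 2 "[?a, ?a]"] by simp
  have w23: "?F 3 [?a, ?b, ?a] = ?F 2 [?a, ?a]"
    using destab[of 2 "[?a]" "[?a]" True] by simp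
  have w24: "?F 3 [?a, ?b, ?a, ?B, ?B, ?b, ?b, ?A, ?b, ?a] = ?F 3 [?a, ?a] + ?z * ?F 3 [?a, ?b, ?a]"
    using moves[of 3 "[?a, ?b, ?a, ?B, ?B, ?b, ?b, ?A, ?b, ?a]" "[4, 3, 2]"]
      square[of 3 "[?a]" "[?a]" 2 True] by simp
  have w25: "?F 4 [?a, ?c, ?b, ?c, ?B, ?a, ?b, ?C, ?C, ?b, ?A, ?b, ?a] = ?F 3 [?a, ?b, ?a, ?B, ?B, ?b, ?b, ?A, ?b, ?a]"
    using moves[of 4 "[?a, ?c, ?b, ?c, ?B, ?a, ?b, ?C, ?C, ?b, ?A, ?b, ?a]" "[1, 3, 2, 3, 4]"]
      destab[of 3 "[?a, ?b, ?a, ?B, ?B]" "[?b, ?b, ?A, ?b, ?a]" True] by simp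
  \<comment> \<open>The root of the tree: -2z^3 from \<open>w21\<close> outweighs z * z^2 from
    \<open>w25\<close>, which leaves -z^3.\<close>
  have w26: "?F 4 [?a, ?B, ?c, ?b, ?A, ?b, ?a, ?B, ?c, ?b, ?b, ?A, ?b, ?a] = ?F 4 [?a, ?c, ?c, ?B, ?a, ?b, ?C, ?C, ?b, ?A, ?b, ?a] + ?z * ?F 4 [?a, ?c, ?b, ?c, ?B, ?a, ?b, ?C, ?C, ?b, ?A, ?b, ?a]"
    using moves[of 4 "[?a, ?B, ?c, ?b, ?A, ?b, ?a, ?B, ?c, ?b, ?b, ?A, ?b, ?a]" "[1, 4, 7, 6, 5, 3]"]
      square[of 4 "[?a, ?c]" "[?c, ?B, ?a, ?b, ?C, ?C, ?b, ?A, ?b, ?a]" 2 True] by simp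
  have "?F 4 [?a, ?B, ?c, ?b, ?A, ?b, ?a, ?B, ?c, ?b, ?b, ?A, ?b, ?a] = [:0, 0, 0, - 1:]"
    unfolding w1 w2 w3 w4 w5 w6 w7 w8 w9 w10 w11 w12 w13 w14 w15 w16 w17 w18 w19 w20 w21 w22 w23
      w24 w25 w26 closure_conway_unknot
    by (simp add: numeral_poly)
  moreover have "example_braid = [?a, ?B, ?c, ?b, ?A, ?b, ?a, ?B, ?c, ?b, ?b, ?A, ?b, ?a]"
    by (simp add: example_braid_def example_bands_def bkl_generator_def inverse_word_def upt_rec)
  ultimately show ?thesis
    by simp
qed

lemma strongly_quasipositive_example: "strongly_quasipositive (braid_closure 4 example_braid)"
proof -
  have "example_braid \<in> braid_words 4"
    by (simp add: example_braid_def example_bands_def bkl_generator_def inverse_word_def upt_rec)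
  \<comment> \<open>The word is by definition the product of its bands, so reflexivity of braid
    equality suffices.\<close>
  moreover from this have "bkl_positive 4 example_braid"
    by (auto simp: bkl_positive_def braid_eq_def example_braid_def example_bands_def
        intro!: exI[of _ example_bands])
  ultimately show ?thesis
    by (auto simp: strongly_quasipositive_def intro!: exI[of _ 4])
qed

theorem proposition5p1:
  fixes conway :: "link \<Rightarrow> int poly"
  assumes "is_conway_polynomial conway"
  shows "\<exists>L. strongly_quasipositive L \<and> \<not> positive_polynomial (conway L)"
proof -
  interpret conway_polynomial conway
    by standard (rule assms)
  have "coeff (conway (braid_closure 4 example_braid)) 3 < 0"
    using closure_conway_example by (simp add: closure_conway_def numeral_3_eq_3)
  then have "\<not> positive_polynomial (conway (braid_closure 4 example_braid))"
    unfolding positive_polynomial_def by (metis not_le)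
  then show ?thesis
    using strongly_quasipositive_example by blast
qed

end
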